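(* Let $n\ge 2$ be an integer and consider the conformal univalent map of the unit disk $\mathbb{D}$ onto a domain convex in the direction of the real axis given by $$F_n(z)=z-\frac{1}{n^2}z^n.$$ Let the dilatation be $\omega(z)=z^n$. Then the horizontal shear of $F_n$ with dilatation $\omega$ is $f_n=h_n+\overline{g_n}$, where $$h_n(z)=z\,{}_2F_1\left(1,\tfrac1n;\tfrac1n+1;z^n\right)+\frac{\log(z^n-1)}{n^2}-\frac{\pi i}{n^2},$$ $$g_n(z)=z\,{}_2F_1\left(1,\tfrac1n;\tfrac{n+1}{n};z^n\right)-z+\frac{\log(z^n-1)+z^n}{n^2}-\frac{\pi i}{n^2},$$ and $f_n\in S_H^0$. In particular, when $n=2m$ is an even positive integer, $f_n$ lifts to a minimal graph over $f_n(\mathbb{D})$ parametrized by $z\in\mathbb{D}\mapsto(x_1,x_2,x_3)$, where $x_1=\operatorname{Re}\{h_n(z)+g_n(z)\}$, $x_2=\operatorname{Im}\{h_n(z)-g_n(z)\}$ and $$x_3=2\operatorname{Im}\left\{\frac12\left[z\,{}_2F_1\left(1,\tfrac1m;\tfrac1m+1;z^m\right)-z\,{}_2F_1\left(1,\tfrac1m;\tfrac1m+1;-z^m\right)\right]-\frac{1}{2m}\left(\frac{\operatorname{atanh}(z^m)-z^m}{m}\right)\right\}.$$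
   Context: $\mathbb{D}=\{z\in\mathbb{C}:|z|<1\}$. A domain is convex in the direction of the real axis if its intersection with every line parallel to the real axis is connected. $S_H^0$ is the family of harmonic univalent mappings $f=h+\overline g:\mathbb{D}\to\mathbb{C}$ with $h,g$ analytic on $\mathbb{D}$ and $h(0)=g(0)=0$, $h'(0)=1$, $g'(0)=0$. The dilatation of $f=h+\overline g$ is $g'/h'$. Given an analytic univalent $F$ on $\mathbb{D}$ with $F(0)=0$ and an analytic $\omega:\mathbb{D}\to\mathbb{D}$, the horizontal shear of $F$ with dilatation $\omega$ is $f=h+\overline g$, where $h,g$ are the analytic functions on $\mathbb{D}$ with $h-g=F$, $g'=\omega h'$, $h(0)=g(0)=0$. ${}_2F_1(a,b;c;z)=\sum_{k=0}^\infty\frac{(a)_k(b)_k}{(c)_k}\frac{z^k}{k!}$ is the hypergeometric function, with $(x)_k=x(x+1)\cdots(x+k-1)$, $(x)_0=1$. The function $\log(z^n-1)$ denotes the analytic branch on $\mathbb{D}$ with value $\pi i$ at $z=0$, and $\operatorname{atanh}$ is the principal branch. A minimal surface is a surface in $\mathbb{R}^3$ with mean curvature zero at every point; a minimal graph over a domain $\Omega\subset\mathbb{C}$ is a minimal surface of the form $\{(u,v,G(u,v)):u+iv\in\Omega\}$ with $G:\Omega\to\mathbb{R}$. To say that $f_n$ lifts to the minimal graph $(x_1,x_2,x_3)$ means that this map parametrizes a minimal graph over $f_n(\mathbb{D})$, with $x_1+ix_2=f_n$. *)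

theory Defs
  imports "HOL-Complex_Analysis.Complex_Analysis"
begin

abbreviation unit_disc :: "complex set" where
  "unit_disc \<equiv> ball 0 1"

definition is_domain :: "complex set \<Rightarrow> bool" where
  "is_domain S \<longleftrightarrow> S \<noteq> {} \<and> open S \<and> connected S"

definition convex_in_real_direction :: "complex set \<Rightarrow> bool" where
  "convex_in_real_direction S \<longleftrightarrow> (\<forall>t::real. connected (S \<inter> {w. Im w = t}))"

definition conformal_univalent_on :: "complex set \<Rightarrow> (complex \<Rightarrow> complex) \<Rightarrow> bool" where
  "conformal_univalent_on S F \<longleftrightarrow>
     F holomorphic_on S \<and> (\<forall>z\<in>S. deriv F z \<noteq> 0) \<and> inj_on F S"

definition S_H0 :: "(complex \<Rightarrow> complex) set" where
  "S_H0 = {f. inj_on f unit_disc \<and>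
     (\<exists>h g. h holomorphic_on unit_disc \<and> g holomorphic_on unit_disc \<and>
        (\<forall>z\<in>unit_disc. f z = h z + cnj (g z)) \<and>
        h 0 = 0 \<and> g 0 = 0 \<and> deriv h 0 = 1 \<and> deriv g 0 = 0)}"

text \<open>The first two lines are the standing requirements on the data \<open>F\<close> and \<open>\<omega>\<close> of a shear.\<close>

definition horizontal_shear ::
  "(complex \<Rightarrow> complex) \<Rightarrow> (complex \<Rightarrow> complex) \<Rightarrow>
   (complex \<Rightarrow> complex) \<Rightarrow> (complex \<Rightarrow> complex) \<Rightarrow> (complex \<Rightarrow> complex) \<Rightarrow> bool" where
  "horizontal_shear F \<omega> h g f \<longleftrightarrow>
     F holomorphic_on unit_disc \<and> inj_on F unit_disc \<and> F 0 = 0 \<and>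
     \<omega> holomorphic_on unit_disc \<and> \<omega> ` unit_disc \<subseteq> unit_disc \<and>
     h holomorphic_on unit_disc \<and> g holomorphic_on unit_disc \<and>
     (\<forall>z\<in>unit_disc. h z - g z = F z \<and> deriv g z = \<omega> z * deriv h z) \<and>
     h 0 = 0 \<and> g 0 = 0 \<and>
     (\<forall>z\<in>unit_disc. f z = h z + cnj (g z))"

lemma horizontal_shear_unique:
  assumes "horizontal_shear F \<omega> h1 g1 f1" "horizontal_shear F \<omega> h2 g2 f2" "z \<in> unit_disc"
  shows "h1 z = h2 z" "g1 z = g2 z" "f1 z = f2 z"
proof -
  have der: "deriv h w * (1 - \<omega> w) = deriv F w"
    if "horizontal_shear F \<omega> h g f" "w \<in> unit_disc" for h g f w
  proof -
    have hol: "h holomorphic_on unit_disc" "g holomorphic_on unit_disc"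
      using that(1) by (auto simp: horizontal_shear_def)
    have "(h has_field_derivative deriv h w) (at w)" "(g has_field_derivative deriv g w) (at w)"
      using hol that(2) by (auto intro: holomorphic_derivI)
    then have "((\<lambda>z. h z - g z) has_field_derivative (deriv h w - deriv g w)) (at w)"
      by (rule DERIV_diff)
    then have "(F has_field_derivative (deriv h w - deriv g w)) (at w)"
      by (rule has_field_derivative_transform_within_open[where S = unit_disc])
         (use that in \<open>auto simp: horizontal_shear_def\<close>)
    then show ?thesis
      using that by (auto simp: horizontal_shear_def algebra_simps dest!: DERIV_imp_deriv)
  qed
  have hol: "h1 holomorphic_on unit_disc" "h2 holomorphic_on unit_disc"
    using assms by (auto simp: horizontal_shear_def)
  have ne: "1 - \<omega> w \<noteq> 0" if "w \<in> unit_disc" for w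
  proof
    assume "1 - \<omega> w = 0"
    moreover have "\<omega> w \<in> unit_disc" using assms(1) that unfolding horizontal_shear_def by blast
    ultimately show False by simp
  qed
  have eq: "deriv h1 w = deriv h2 w" if "w \<in> unit_disc" for w
    using der[OF assms(1) that] der[OF assms(2) that] ne[OF that]
    by (metis mult_right_cancel)
  have "((\<lambda>z. h1 z - h2 z) has_field_derivative 0) (at w within unit_disc)"
    if "w \<in> unit_disc" for w
    using DERIV_diff[OF holomorphic_derivI[OF hol(1) open_ball that]
        holomorphic_derivI[OF hol(2) open_ball that]] eq[OF that]
    by simp
  then obtain c where c: "\<And>w. w \<in> unit_disc \<Longrightarrow> h1 w - h2 w = c"
    using has_field_derivative_zero_constant[of unit_disc "\<lambda>z. h1 z - h2 z"] by auto
  have "c = 0"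
    using c[of 0] assms by (simp add: horizontal_shear_def)
  then show h: "h1 z = h2 z" using c[OF assms(3)] by simp
  then show g: "g1 z = g2 z" using assms unfolding horizontal_shear_def
    by (metis diff_diff_eq2 diff_add_cancel add_diff_cancel_left')
  show "f1 z = f2 z" using h g assms unfolding horizontal_shear_def by metis
qed

definition hyp2F1 :: "complex \<Rightarrow> complex \<Rightarrow> complex \<Rightarrow> complex \<Rightarrow> complex" where
  "hyp2F1 a b c z = eval_fps (fps_hypergeo [a, b] [c] 1) z"

lemma hyp2F1_altdef:
  "hyp2F1 a b c z =
     (\<Sum>k. pochhammer a k * pochhammer b k / pochhammer c k * (z ^ k / fact k))"
  by (simp add: hyp2F1_def eval_fps_def)

text \<open>
  \<open>L\<close> is the branch of \<open>log (z ^ n - 1)\<close> on the disc with value \<open>\<pi> \<i>\<close> at the origin.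
  It is not \<open>Ln (z ^ n - 1)\<close>: the range of \<open>z ^ n - 1\<close> meets the cut of the principal branch.
\<close>

definition is_log_branch :: "nat \<Rightarrow> (complex \<Rightarrow> complex) \<Rightarrow> bool" where
  "is_log_branch n L \<longleftrightarrow>
     L holomorphic_on unit_disc \<and> (\<forall>z\<in>unit_disc. exp (L z) = z ^ n - 1) \<and>
     L 0 = complex_of_real pi * \<i>"

lemma is_log_branch_exists:
  assumes "n \<ge> 1"
  shows "is_log_branch n (\<lambda>z. Ln (1 - z ^ n) + complex_of_real pi * \<i>)"
proof -
  have *: "Re (1 - z ^ n) > 0" if "z \<in> unit_disc" for z
  proof -
    have "norm (z ^ n) < 1"
      using that assms by (simp add: norm_power power_less_one_iff)
    then show ?thesis using complex_Re_le_cmod[of "z ^ n"] by simp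
  qed
  then have "1 - z ^ n \<notin> \<real>\<^sub>\<le>\<^sub>0" "1 - z ^ n \<noteq> 0" if "z \<in> unit_disc" for z
    using that by (force simp: complex_nonpos_Reals_iff)+
  then show ?thesis
    using assms by (auto simp: is_log_branch_def exp_add intro!: holomorphic_intros)
qed

text \<open>
  Surfaces in space are described by local parametrizations whose parameter plane is
  \<open>complex\<close>; the coordinate directions are \<open>1\<close> and \<open>\<i>\<close>.
\<close>

definition partial_u :: "(complex \<Rightarrow> real ^ 3) \<Rightarrow> complex \<Rightarrow> real ^ 3" where
  "partial_u X z = frechet_derivative X (at z) 1"

definition partial_v :: "(complex \<Rightarrow> real ^ 3) \<Rightarrow> complex \<Rightarrow> real ^ 3" where
  "partial_v X z = frechet_derivative X (at z) \<i>"

definition C1_on :: "complex set \<Rightarrow> (complex \<Rightarrow> real ^ 3) \<Rightarrow> bool" where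
  "C1_on U X \<longleftrightarrow> (\<forall>z\<in>U. X differentiable at z) \<and>
     continuous_on U (partial_u X) \<and> continuous_on U (partial_v X)"

definition C2_on :: "complex set \<Rightarrow> (complex \<Rightarrow> real ^ 3) \<Rightarrow> bool" where
  "C2_on U X \<longleftrightarrow> C1_on U X \<and> C1_on U (partial_u X) \<and> C1_on U (partial_v X)"

definition surface_normal :: "(complex \<Rightarrow> real ^ 3) \<Rightarrow> complex \<Rightarrow> real ^ 3" where
  "surface_normal X z =
     (let N = cross3 (partial_u X z) (partial_v X z) in N /\<^sub>R norm N)"

definition mean_curvature :: "(complex \<Rightarrow> real ^ 3) \<Rightarrow> complex \<Rightarrow> real" where
  "mean_curvature X z =
     (let E = partial_u X z \<bullet> partial_u X z;
          F = partial_u X z \<bullet> partial_v X z;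
          G = partial_v X z \<bullet> partial_v X z;
          N = surface_normal X z;
          e = partial_u (partial_u X) z \<bullet> N;
          f = partial_v (partial_u X) z \<bullet> N;
          g = partial_v (partial_v X) z \<bullet> N
      in (e * G - 2 * f * F + g * E) / (2 * (E * G - F\<^sup>2)))"

definition regular_patch :: "complex set \<Rightarrow> (complex \<Rightarrow> real ^ 3) \<Rightarrow> bool" where
  "regular_patch U X \<longleftrightarrow>
     open U \<and> C2_on U X \<and> (\<exists>Y. homeomorphism U (X ` U) X Y) \<and>
     (\<forall>z\<in>U. cross3 (partial_u X z) (partial_v X z) \<noteq> 0)"

definition local_parametrization :: "(real ^ 3) set \<Rightarrow> complex set \<Rightarrow> (complex \<Rightarrow> real ^ 3) \<Rightarrow> bool" where
  "local_parametrization S U X \<longleftrightarrow>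
     regular_patch U X \<and> openin (top_of_set S) (X ` U)"

text \<open>
  The vanishing of the mean curvature at a point does not depend on the local parametrization
  in which it is computed.
\<close>

definition minimal_surface :: "(real ^ 3) set \<Rightarrow> bool" where
  "minimal_surface S \<longleftrightarrow>
     (\<forall>p\<in>S. \<exists>U X z. local_parametrization S U X \<and> z \<in> U \<and> X z = p \<and> mean_curvature X z = 0)"

definition graph_over :: "complex set \<Rightarrow> (complex \<Rightarrow> real) \<Rightarrow> (real ^ 3) set" where
  "graph_over \<Omega> G = {vector [Re w, Im w, G w] | w. w \<in> \<Omega>}"

definition minimal_graph :: "complex set \<Rightarrow> (real ^ 3) set \<Rightarrow> bool" where
  "minimal_graph \<Omega> S \<longleftrightarrow>
     is_domain \<Omega> \<and> (\<exists>G. S = graph_over \<Omega> G) \<and> minimal_surface S"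

definition lifts_to_minimal_graph :: "(complex \<Rightarrow> complex) \<Rightarrow> (complex \<Rightarrow> real ^ 3) \<Rightarrow> bool" where
  "lifts_to_minimal_graph f X \<longleftrightarrow>
     minimal_graph (f ` unit_disc) (X ` unit_disc) \<and> regular_patch unit_disc X \<and>
     (\<forall>z\<in>unit_disc. Complex (X z $ 1) (X z $ 2) = f z)"

end

theory Submission
  imports Defs
begin

text \<open>
  \<open>F\<close> differs from the identity by a contraction of the closed disc with constant \<open>1 / n\<close>; this
  gives its injectivity and, by a fixed point argument, the convexity of its image. The
  Clunie--Sheil-Small argument (shearing fixes horizontal lines and is increasing on them) then
  gives univalence of the shear. Termwise, \<open>z hyp2F1 1 (1 / n) (1 / n + 1) (z ^ n)\<close> is a primitive of
  \<open>1 / (1 - z ^ n)\<close>, whence \<open>h' = (1 - z ^ (n - 1) / n) / (1 - z ^ n)\<close> and \<open>g' = z ^ n h'\<close>. For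
  \<open>n = 2 m\<close> the dilatation is the square of \<open>z ^ m\<close>, so \<open>x\<^sub>3 = 2 Im \<integral> z ^ m h'\<close> completes \<open>f\<close>
  to a conformal harmonic, hence minimal, parametrization.
\<close>

section \<open>Hypergeometric primitives\<close>

text \<open>With \<open>b = 1 / n\<close>, the quotient of the Pochhammer symbols of
  \<open>b\<close> and \<open>b + 1\<close> telescopes to \<open>b / (b + k)\<close>, while that of
  \<open>1\<close> cancels \<open>fact k\<close>.\<close>

lemma hyp2F1_one_inverse:
  fixes n :: nat and w :: complex
  assumes "n > 0"
  shows "hyp2F1 1 (1 / of_nat n) (1 / of_nat n + 1) w = (\<Sum>k. 1 / of_nat (n * k + 1) * w ^ k)"
proof -
  define b :: complex where "b = 1 / of_nat n"
  have b: "b + of_nat k = of_nat (n * k + 1) / of_nat n" for k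
    using assms by (simp add: b_def field_simps)
  have ne: "b + of_nat k \<noteq> 0" for k
    using assms by (simp only: b) (simp del: of_nat_Suc of_nat_mult of_nat_add)
  have "pochhammer (b + 1) k \<noteq> 0" for k
    using ne[of "Suc j" for j] by (auto simp: pochhammer_eq_0_iff eq_neg_iff_add_eq_0 algebra_simps)
  moreover have "b * pochhammer (b + 1) k = pochhammer b k * (b + of_nat k)" for k
    using pochhammer_rec[of b k] pochhammer_Suc[of b k] by simp
  ultimately have quot: "pochhammer b k / pochhammer (b + 1) k = b / (b + of_nat k)" for k
    using ne[of k] by (simp add: field_simps)
  have "b / (b + of_nat k) = 1 / of_nat (n * k + 1)" for k
    using assms by (simp only: b) (simp add: b_def del: of_nat_Suc of_nat_mult of_nat_add)
  then have "pochhammer 1 k * pochhammer b k / pochhammer (b + 1) k * (w ^ k / fact k)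
      = 1 / of_nat (n * k + 1) * w ^ k" for k
    by (metis fact_nonzero nonzero_mult_div_cancel_left pochhammer_fact quot times_divide_eq_left
        times_divide_eq_right)
  then show ?thesis
    by (simp add: hyp2F1_altdef b_def)
qed

text \<open>Comparing coefficients, the series \<open>H\<close> satisfies
  \<open>H w + n w H' w = 1 / (1 - w)\<close>, and at \<open>w = e z ^ n\<close> the left side is
  the derivative of \<open>z H (e z ^ n)\<close>. The factor \<open>e\<close> serves both signs of
  \<open>z ^ m\<close> in the third coordinate.\<close>

lemma has_field_derivative_hyp2F1_one_inverse:
  fixes n :: nat and e z :: complex
  assumes "n > 0" "norm e \<le> 1" "norm z < 1"
  shows "((\<lambda>z. z * hyp2F1 1 (1 / of_nat n) (1 / of_nat n + 1) (e * z ^ n))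
           has_field_derivative 1 / (1 - e * z ^ n)) (at z)"
proof -
  define c :: "nat \<Rightarrow> complex" where "c k = 1 / of_nat (n * k + 1)" for k
  define H where "H w = (\<Sum>k. c k * w ^ k)" for w
  define D where "D w = (\<Sum>k. diffs c k * w ^ k)" for w
  have norm_c: "norm (c k) \<le> 1" for k
    by (simp add: c_def norm_divide del: of_nat_Suc of_nat_add of_nat_mult)
  have summ: "summable (\<lambda>k. c k * w ^ k)" if "norm w < 1" for w
  proof (rule summable_comparison_test)
    show "\<exists>N. \<forall>k\<ge>N. norm (c k * w ^ k) \<le> norm w ^ k"
      using norm_c by (auto simp: norm_mult norm_power intro!: exI[of _ 0] mult_left_le_one_le)
    show "summable (\<lambda>k. norm w ^ k)"
      using that by (simp add: summable_geometric)
  qed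
  have H': "(H has_field_derivative D w) (at w)" if "norm w < 1" for w
    unfolding H_def[abs_def] D_def using termdiffs_strong'[of 1 c w] summ that by blast
  have ode: "H w + of_nat n * w * D w = 1 / (1 - w)" if w: "norm w < 1" for w
  proof -
    have "summable (\<lambda>k. diffs c k * w ^ k)"
      by (rule termdiff_converges[OF w]) (rule summ)
    then have "(\<lambda>k. of_nat k * c k * w ^ (k - Suc 0)) sums D w"
      unfolding D_def by (rule diffs_equiv)
    then have "(\<lambda>k. of_nat n * w * (of_nat k * c k * w ^ (k - Suc 0))) sums (of_nat n * w * D w)"
      by (rule sums_mult)
    moreover have "(\<lambda>k. c k * w ^ k) sums H w"
      unfolding H_def using summ[OF w] by (rule summable_sums)
    ultimately have "(\<lambda>k. c k * w ^ k + of_nat n * w * (of_nat k * c k * w ^ (k - Suc 0)))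
        sums (H w + of_nat n * w * D w)"
      by (rule sums_add[rotated])
    \<comment> \<open>At \<open>k = 0\<close> the truncated exponent \<open>k - Suc 0\<close> is
      harmless, since the factor \<open>of_nat k\<close> vanishes.\<close>
    moreover have "c k * w ^ k + of_nat n * w * (of_nat k * c k * w ^ (k - Suc 0)) = w ^ k" for k
    proof -
      have "c k * w ^ k + of_nat n * w * (of_nat k * c k * w ^ (k - Suc 0))
          = (of_nat (n * k + 1) * c k) * w ^ k"
        by (cases k) (simp_all add: algebra_simps)
      also have "of_nat (n * k + 1) * c k = 1"
        unfolding c_def using of_nat_neq_0[of "n * k", where 'a = complex] by simp
      finally show ?thesis by simp
    qed
    ultimately show ?thesis
      using geometric_sums[OF w] sums_unique2 by force
  qed
  have w: "norm (e * z ^ n) < 1"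
  proof -
    have "norm z ^ n < 1"
      using assms by (simp add: power_less_one_iff)
    then show ?thesis
      using assms mult_left_le_one_le[of "norm z ^ n" "norm e"] by (simp add: norm_mult norm_power)
  qed
  have "((\<lambda>z. z * H (e * z ^ n)) has_field_derivative
      H (e * z ^ n) + z * (D (e * z ^ n) * (e * (of_nat n * z ^ (n - 1))))) (at z)"
    using H'[OF w] by (auto intro!: derivative_eq_intros DERIV_chain2[of H])
  moreover have "z * z ^ (n - 1) = z ^ n"
    using assms by (metis power_eq_if not_gr_zero)
  then have "z * (D (e * z ^ n) * (e * (of_nat n * z ^ (n - 1))))
      = of_nat n * (e * z ^ n) * D (e * z ^ n)"
    by (simp add: algebra_simps)
  ultimately have "((\<lambda>z. z * H (e * z ^ n)) has_field_derivative 1 / (1 - e * z ^ n)) (at z)"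
    using ode[OF w] by (simp only:)
  then show ?thesis
    by (simp add: hyp2F1_one_inverse[OF assms(1)] H_def c_def)
qed

text \<open>\<open>artanh z\<close> is half of \<open>Ln ((1 + z) / (1 - z))\<close>, and on the
  disc this quotient avoids the branch cut of \<open>Ln\<close>.\<close>

lemma artanh_has_field_derivative_complex:
  fixes z :: complex
  assumes "norm z < 1"
  shows "(artanh has_field_derivative 1 / (1 - z ^ 2)) (at z)"
proof -
  have ne: "1 - z \<noteq> 0" "1 + z \<noteq> 0"
    using assms by (auto simp: add_eq_0_iff)
  have "(1 + z) / (1 - z) \<notin> \<real>\<^sub>\<le>\<^sub>0"
  proof
    assume "(1 + z) / (1 - z) \<in> \<real>\<^sub>\<le>\<^sub>0"
    then obtain r where r: "r \<le> 0" "(1 + z) / (1 - z) = complex_of_real r"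
      by (auto elim!: nonpos_Reals_cases)
    then have "1 + z = of_real r * (1 - z)"
      using ne by (simp add: field_simps)
    \<comment> \<open>Taking norms gives \<open>\<bar>r - 1\<bar> \<le> \<bar>1 + r\<bar>\<close>,
      which for \<open>r \<le> 0\<close> leaves only \<open>r = 0\<close>, that is
      \<open>z = -1\<close>.\<close>
    then have "z * of_real (1 + r) = of_real (r - 1)"
      by (simp add: algebra_simps)
    then have "norm z * \<bar>1 + r\<bar> = \<bar>r - 1\<bar>"
      by (metis norm_mult norm_of_real)
    moreover have "norm z * \<bar>1 + r\<bar> \<le> \<bar>1 + r\<bar>"
      using assms by (intro mult_left_le_one_le) auto
    ultimately have "r = 0"
      using r(1) by linarith
    with r(2) ne show False by simp
  qed
  then have Ln: "(Ln has_field_derivative inverse ((1 + z) / (1 - z))) (at ((1 + z) / (1 - z)))"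
    by (rule has_field_derivative_Ln)
  have "((\<lambda>z. (1 + z) / (1 - z)) has_field_derivative
      ((0 + 1) * (1 - z) - (1 + z) * (0 - 1)) / ((1 - z) * (1 - z))) (at z)"
    using ne by (intro DERIV_divide DERIV_diff DERIV_add DERIV_const DERIV_ident)
  moreover have "(0 + 1) * (1 - z) - (1 + z) * (0 - 1) = 2"
    by (simp add: algebra_simps)
  ultimately have div: "((\<lambda>z. (1 + z) / (1 - z)) has_field_derivative 2 / ((1 - z) * (1 - z))) (at z)"
    by (simp only:)
  have quot: "inverse (b / a) * (2 / (a * a)) / 2 = 1 / (a * b)" if "a \<noteq> 0" "b \<noteq> 0" for a b :: complex
    using that by (simp add: field_simps)
  from DERIV_cdivide[OF DERIV_chain2[OF Ln div], of 2]
  have "((\<lambda>z. Ln ((1 + z) / (1 - z)) / 2) has_field_derivative 1 / ((1 - z) * (1 + z))) (at z)"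
    by (simp only: quot[OF ne])
  moreover have "(1 - z) * (1 + z) = 1 - z ^ 2"
    by (simp add: power2_eq_square algebra_simps)
  ultimately have "((\<lambda>z. Ln ((1 + z) / (1 - z)) / 2) has_field_derivative 1 / (1 - z ^ 2)) (at z)"
    by simp
  then show ?thesis
    by (simp add: artanh_def[abs_def])
qed

section \<open>The image of the disc under \<open>z - z ^ n / n\<^sup>2\<close>\<close>

text \<open>The defect at \<open>Suc n\<close> is \<open>c\<close> times the defect at
  \<open>n\<close> plus \<open>t (1 - t) (a - b) (a ^ n - b ^ n)\<close>. Since
  \<open>norm c \<le> 1\<close> and the power is \<open>n\<close>-Lipschitz on the closed disc, each
  step adds at most \<open>n t (1 - t) \<bar>a - b\<bar>\<^sup>2\<close>; the coefficients
  \<open>0, ..., n - 1\<close> sum to \<open>n (n - 1) / 2\<close>.\<close>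

lemma norm_convex_combination_power_diff:
  fixes a b :: complex and t :: real
  assumes "norm a \<le> 1" "norm b \<le> 1" "0 \<le> t" "t \<le> 1"
  defines "c \<equiv> (1 - t) *\<^sub>R a + t *\<^sub>R b"
  shows "norm ((1 - t) *\<^sub>R a ^ n + t *\<^sub>R b ^ n - c ^ n)
           \<le> real n * (real n - 1) / 2 * (t * (1 - t) * (norm (a - b))\<^sup>2)"
proof (induction n)
  case 0
  then show ?case
    by (simp add: scaleR_conv_of_real algebra_simps)
next
  case (Suc n)
  define s where "s = t * (1 - t) * (norm (a - b))\<^sup>2"
  define d where "d = (1 - t) *\<^sub>R a ^ n + t *\<^sub>R b ^ n - c ^ n"
  have "c \<in> cball 0 1"
    unfolding c_def using assms by (intro convexD) auto
  then have c: "norm c \<le> 1" by simp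
  have "(1 - t) *\<^sub>R a ^ Suc n + t *\<^sub>R b ^ Suc n - c ^ Suc n
      = c * d + (t * (1 - t)) *\<^sub>R ((a - b) * (a ^ n - b ^ n))"
    by (simp add: d_def c_def scaleR_conv_of_real algebra_simps)
  also have "norm \<dots> \<le> norm c * norm d + t * (1 - t) * (norm (a - b) * norm (a ^ n - b ^ n))"
    using assms by (intro order.trans[OF norm_triangle_ineq]) (simp add: norm_mult)
  also have "\<dots> \<le> 1 * norm d + t * (1 - t) * (norm (a - b) * (n * norm (a - b)))"
    using assms c norm_power_diff[of a b n]
    by (intro add_mono mult_mono mult_left_mono) auto
  also have "\<dots> \<le> real n * (real n - 1) / 2 * s + n * s"
    using Suc.IH by (simp add: d_def s_def power2_eq_square algebra_simps)
  also have "\<dots> = real (Suc n) * (real (Suc n) - 1) / 2 * s"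
    by (simp add: field_simps)
  finally show ?case by (simp add: s_def)
qed

text \<open>The subtracted term measures the strict convexity of the norm; it provides the room
  around a convex combination in which a fixed point is later found.\<close>

lemma norm_convex_combination_power2:
  fixes a b :: "'a :: real_inner"
  shows "(norm ((1 - t) *\<^sub>R a + t *\<^sub>R b))\<^sup>2
           = (1 - t) * (norm a)\<^sup>2 + t * (norm b)\<^sup>2 - t * (1 - t) * (norm (a - b))\<^sup>2"
  unfolding power2_norm_eq_inner
  by (simp add: inner_simps inner_commute algebra_simps)

text \<open>The power has Lipschitz constant \<open>n\<close> on the closed disc, so division by
  \<open>n ^ 2\<close> leaves \<open>1 / n\<close>.\<close>

lemma norm_power_quotient_diff:
  fixes z w :: complex
  assumes "norm z \<le> 1" "norm w \<le> 1" "n > 0"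
  shows "norm (z ^ n / of_nat n ^ 2 - w ^ n / of_nat n ^ 2) \<le> norm (z - w) / n"
proof -
  have "norm (z ^ n / of_nat n ^ 2 - w ^ n / of_nat n ^ 2) = norm (z ^ n - w ^ n) / real n ^ 2"
    by (simp add: diff_divide_distrib[symmetric] norm_divide norm_power)
  also have "\<dots> \<le> (n * norm (z - w)) / real n ^ 2"
    using norm_power_diff[OF assms(1,2), of n] by (intro divide_right_mono) auto
  also have "\<dots> = norm (z - w) / n"
    using assms by (simp add: power2_eq_square)
  finally show ?thesis .
qed

lemma inj_on_id_minus_power:
  fixes n :: nat
  assumes "n \<ge> 2"
  shows "inj_on (\<lambda>z::complex. z - z ^ n / of_nat n ^ 2) (cball 0 1)"
proof (rule inj_onI)
  fix z w :: complex
  assume *: "z \<in> cball 0 1" "w \<in> cball 0 1"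
    and "z - z ^ n / of_nat n ^ 2 = w - w ^ n / of_nat n ^ 2"
  then have "z - w = z ^ n / of_nat n ^ 2 - w ^ n / of_nat n ^ 2"
    by (simp add: algebra_simps)
  then have "norm (z - w) \<le> norm (z - w) / n"
    using norm_power_quotient_diff[of z w n] * assms by simp
  also have "\<dots> \<le> norm (z - w) / 2"
    using assms by (intro divide_left_mono) auto
  finally show "z = w" by simp
qed

text \<open>
  A preimage of a convex combination of the images of \<open>a\<close> and \<open>b\<close> is a fixed point of
  \<open>z \<mapsto> w + z ^ n / n\<^sup>2\<close>. With \<open>s = t (1 - t) \<bar>a - b\<bar>\<^sup>2\<close> this map preserves the closed ball
  of radius \<open>s / 2\<close> about \<open>c = (1 - t) a + t b\<close>, and that ball lies in the unit disc because
  \<open>\<bar>c\<bar>\<^sup>2 < 1 - s \<le> (1 - s / 2)\<^sup>2\<close>.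
\<close>

lemma convex_image_id_minus_power:
  fixes n :: nat
  assumes n: "n \<ge> 2"
  shows "convex ((\<lambda>z::complex. z - z ^ n / of_nat n ^ 2) ` ball 0 1)"
  unfolding convex_alt
proof (intro ballI allI impI)
  define F where "F = (\<lambda>z::complex. z - z ^ n / of_nat n ^ 2)"
  fix x y :: complex and t :: real
  assume "x \<in> F ` ball 0 1" "y \<in> F ` ball 0 1" and "0 \<le> t \<and> t \<le> 1"
  then obtain a b where ab: "norm a < 1" "norm b < 1" "x = F a" "y = F b" and t: "0 \<le> t" "t \<le> 1"
    by auto
  define s where "s = t * (1 - t) * (norm (a - b))\<^sup>2"
  define c where "c = (1 - t) *\<^sub>R a + t *\<^sub>R b"
  define w where "w = (1 - t) *\<^sub>R x + t *\<^sub>R y"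
  define T where "T z = w + z ^ n / of_nat n ^ 2" for z
  have s: "0 \<le> s"
    using t by (simp add: s_def)
  have "(norm a)\<^sup>2 < 1" "(norm b)\<^sup>2 < 1"
    using ab by (simp_all add: power_less_one_iff)
  then have "(1 - t) * (norm a)\<^sup>2 + t * (norm b)\<^sup>2 < 1"
    using t convex_bound_lt[of "(norm a)\<^sup>2" 1 "(norm b)\<^sup>2" "1 - t" t] by simp
  then have c2: "(norm c)\<^sup>2 < 1 - s"
    by (simp add: c_def s_def norm_convex_combination_power2)
  \<comment> \<open>This makes \<open>1 - s / 2\<close> nonnegative, so that the comparison of
    squares below yields one of norms.\<close>
  then have "s < 1"
    by (smt (verit) zero_le_power2)
  moreover have "1 - s \<le> (1 - s / 2)\<^sup>2"
    by (simp add: power2_eq_square algebra_simps)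
  ultimately have c: "norm c < 1 - s / 2"
    using c2 by (intro power2_less_imp_less[of "norm c"]) auto
  have sub: "norm z < 1" if "z \<in> cball c (s / 2)" for z
    using that c norm_triangle_ineq2[of z c] by (simp add: dist_norm norm_minus_commute)
  have "T z \<in> cball c (s / 2)" if z: "z \<in> cball c (s / 2)" for z
  proof -
    define d where "d = (1 - t) *\<^sub>R a ^ n + t *\<^sub>R b ^ n - c ^ n"
    \<comment> \<open>The error splits into a Lipschitz difference between \<open>z\<close> and
      \<open>c\<close> and the convexity defect \<open>d\<close> of the power.\<close>
    have "T z - c = (z ^ n / of_nat n ^ 2 - c ^ n / of_nat n ^ 2) - d / of_nat n ^ 2"
      by (simp add: T_def w_def c_def d_def ab F_def scaleR_conv_of_real algebra_simps
          add_divide_distrib diff_divide_distrib)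
    also have "norm \<dots> \<le> norm (z - c) / n + norm d / real n ^ 2"
      using norm_power_quotient_diff[of z c n] sub[OF z] c s n
      by (intro order.trans[OF norm_triangle_ineq4]) (simp add: norm_divide norm_power)
    also have "norm d \<le> real n * (real n - 1) / 2 * s"
      unfolding d_def c_def s_def
      using norm_convex_combination_power_diff[of a b t n] ab t by simp
    also have "norm (z - c) \<le> s / 2"
      using z by (simp add: dist_norm norm_minus_commute)
    \<comment> \<open>The shares \<open>1 / (2 n)\<close> and \<open>(n - 1) / (2 n)\<close> of
      \<open>s\<close> add up to \<open>s / 2\<close>, the smallest radius that this estimate
      preserves.\<close>
    also have "s / 2 / n + real n * (real n - 1) / 2 * s / real n ^ 2 = s / 2"
      using n by (simp add: field_simps power2_eq_square)
    finally show ?thesis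
      using n by (simp add: dist_norm norm_minus_commute divide_right_mono)
  qed
  moreover have "continuous_on (cball c (s / 2)) T"
    unfolding T_def by (intro continuous_intros) (use n in auto)
  ultimately obtain z where z: "z \<in> cball c (s / 2)" "T z = z"
    using brouwer[of "cball c (s / 2)" T] s by (auto simp: Pi_iff)
  then have "F z = w"
    by (simp add: T_def F_def algebra_simps)
  then show "(1 - t) *\<^sub>R x + t *\<^sub>R y \<in> F ` ball 0 1"
    using sub[OF z(1)] by (intro image_eqI[of _ _ z]) (simp_all add: w_def)
qed

lemma convex_imp_convex_in_real_direction:
  assumes "convex S"
  shows "convex_in_real_direction S"
  unfolding convex_in_real_direction_def
proof (intro allI convex_connected convex_Int assms)
  show "convex {w. Im w = t}" for t
    by (auto simp: convex_def algebra_simps simp flip: distrib_left)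
       (simp add: algebra_simps flip: distrib_right)
qed

section \<open>Univalence of the shear\<close>

text \<open>The real parts of a horizontal slice form a connected set of reals, hence an
  interval.\<close>

lemma convex_in_real_directionD:
  assumes "convex_in_real_direction S" "w1 \<in> S" "w2 \<in> S" "Im w1 = Im w2"
    and "Re w1 \<le> x" "x \<le> Re w2"
  shows "Complex x (Im w1) \<in> S"
proof -
  let ?A = "S \<inter> {w. Im w = Im w1}"
  have "connected (Re ` ?A)"
    using assms(1) unfolding convex_in_real_direction_def
    by (intro connected_continuous_image continuous_intros) auto
  moreover have "Re w1 \<in> Re ` ?A" "Re w2 \<in> Re ` ?A"
    using assms by auto
  ultimately have "x \<in> Re ` ?A"
    using connected_contains_Icc[of "Re ` ?A" "Re w1" "Re w2"] assms by auto
  then show ?thesis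
    by (auto simp: complex_eq_iff) (metis complex.collapse)
qed

text \<open>
  Composed with the inverse \<open>G\<close> of \<open>F\<close>, the shear becomes \<open>w \<mapsto> w + 2 Re (g (G w))\<close>. It fixes
  horizontal lines, and along them its derivative is \<open>Re ((1 + \<omega>) / (1 - \<omega>)) > 0\<close>.
\<close>

lemma horizontal_shear_inj_on:
  assumes shear: "horizontal_shear F \<omega> h g f"
    and conv: "convex_in_real_direction (F ` unit_disc)"
  shows "inj_on f unit_disc"
proof -
  have hol: "F holomorphic_on unit_disc" "h holomorphic_on unit_disc" "g holomorphic_on unit_disc"
    and inj: "inj_on F unit_disc"
    and F_eq: "\<And>z. z \<in> unit_disc \<Longrightarrow> F z = h z - g z"
    and g': "\<And>z. z \<in> unit_disc \<Longrightarrow> deriv g z = \<omega> z * deriv h z"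
    and \<omega>: "\<And>z. z \<in> unit_disc \<Longrightarrow> norm (\<omega> z) < 1"
    and f: "\<And>z. z \<in> unit_disc \<Longrightarrow> f z = h z + cnj (g z)"
    using shear by (auto simp: horizontal_shear_def image_subset_iff)
  obtain G where G: "G holomorphic_on (F ` unit_disc)"
    "\<And>z. z \<in> unit_disc \<Longrightarrow> deriv F z * deriv G (F z) = 1"
    "\<And>z. z \<in> unit_disc \<Longrightarrow> G (F z) = z"
    using holomorphic_has_inverse[OF hol(1) open_ball inj] by blast
  have openF: "open (F ` unit_disc)"
    using open_mapping_thm3[OF hol(1) open_ball inj] .
  \<comment> \<open>Without the real part around \<open>g (G w)\<close>, \<open>\<Phi>\<close> stays
    holomorphic and the complex chain rule applies; only its real part is compared with
    \<open>f\<close>.\<close>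
  define \<Phi> where "\<Phi> w = w + 2 * g (G w)" for w
  have Re_f: "Re (f z) = Re (\<Phi> (F z))" and Im_f: "Im (f z) = Im (F z)" if "z \<in> unit_disc" for z
    using that G(3)[OF that] by (simp_all add: \<Phi>_def f F_eq)
  have \<Phi>': "\<exists>d. (\<Phi> has_field_derivative d) (at w) \<and> Re d > 0" if w: "w \<in> F ` unit_disc" for w
  proof -
    obtain z where z: "z \<in> unit_disc" "w = F z"
      using w by auto
    have "deriv F z = deriv (\<lambda>z. h z - g z) z"
      by (rule complex_derivative_transform_within_open[OF hol(1) _ open_ball z(1)])
         (auto intro!: holomorphic_intros hol F_eq)
    also have "\<dots> = deriv h z - deriv g z"
      using hol z(1) by (intro deriv_diff) (auto intro: holomorphic_on_imp_differentiable_at)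
    finally have F': "deriv F z = (1 - \<omega> z) * deriv h z"
      using g'[OF z(1)] by (simp add: algebra_simps)
    \<comment> \<open>The product \<open>deriv F z\<close> is invertible, with inverse
      \<open>deriv G (F z)\<close>, so neither factor vanishes.\<close>
    then have ne: "1 - \<omega> z \<noteq> 0" "deriv h z \<noteq> 0"
      using G(2)[OF z(1)] by auto
    have "deriv G w = 1 / deriv F z"
      using G(2)[OF z(1)] z(2) by (metis mult_eq_0_iff nonzero_mult_div_cancel_left zero_neq_one)
    then have "1 + 2 * (deriv g z * deriv G w) = 1 + 2 * \<omega> z / (1 - \<omega> z)"
      using ne by (simp add: F' g'[OF z(1)])
    also have "\<dots> = (1 + \<omega> z) / (1 - \<omega> z)"
      using ne by (simp add: field_simps)
    also have "Re \<dots> = Re ((1 + \<omega> z) * cnj (1 - \<omega> z)) / (norm (1 - \<omega> z))\<^sup>2"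
      by (simp only: complex_div_cnj[of "1 + \<omega> z"] Re_divide_of_real of_real_power[symmetric])
    also have "Re ((1 + \<omega> z) * cnj (1 - \<omega> z)) = 1 - (norm (\<omega> z))\<^sup>2"
      by (simp only: cmod_power2) (simp add: power2_eq_square algebra_simps)
    also have "(1 - (norm (\<omega> z))\<^sup>2) / (norm (1 - \<omega> z))\<^sup>2 > 0"
      using \<omega>[OF z(1)] ne by (intro divide_pos_pos) (auto simp: power_less_one_iff)
    finally have pos: "Re (1 + 2 * (deriv g z * deriv G w)) > 0" .
    have "(G has_field_derivative deriv G w) (at w)"
      using G(1) openF w by (rule holomorphic_derivI)
    moreover have "(g has_field_derivative deriv g z) (at (G w))"
      using holomorphic_derivI[OF hol(3) open_ball z(1)] z by (simp add: G)
    ultimately have "((\<lambda>w. g (G w)) has_field_derivative deriv g z * deriv G w) (at w)"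
      by (rule DERIV_chain2[rotated])
    then have "(\<Phi> has_field_derivative 1 + 2 * (deriv g z * deriv G w)) (at w)"
      unfolding \<Phi>_def by (auto intro!: derivative_eq_intros)
    with pos show ?thesis by blast
  qed
  have less: "Re (\<Phi> w1) < Re (\<Phi> w2)"
    if w: "w1 \<in> F ` unit_disc" "w2 \<in> F ` unit_disc" "Im w1 = Im w2" "Re w1 < Re w2" for w1 w2
  proof -
    have "Re (\<Phi> (Complex (Re w1) (Im w1))) < Re (\<Phi> (Complex (Re w2) (Im w1)))"
    proof (rule DERIV_pos_imp_increasing[OF w(4)])
      fix x assume x: "Re w1 \<le> x" "x \<le> Re w2"
      obtain d where d: "(\<Phi> has_field_derivative d) (at (Complex x (Im w1)))" "Re d > 0"
        using \<Phi>'[OF convex_in_real_directionD[OF conv w(1,2,3) x]] by blast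
      have "(\<lambda>x. Complex x (Im w1)) = (\<lambda>x. of_real x + \<i> * of_real (Im w1))"
        by (simp add: complex_eq_iff fun_eq_iff)
      then have "((\<lambda>x. Complex x (Im w1)) has_vector_derivative 1) (at x)"
        by (auto intro!: derivative_eq_intros simp: has_vector_derivative_def scaleR_conv_of_real)
      then have "((\<Phi> \<circ> (\<lambda>x. Complex x (Im w1))) has_vector_derivative 1 * d) (at x)"
        using d(1) by (rule field_vector_diff_chain_at)
      then have "((\<lambda>x. Re (\<Phi> (Complex x (Im w1)))) has_vector_derivative Re d) (at x)"
        using bounded_linear.has_vector_derivative[OF bounded_linear_Re] by (fastforce simp: o_def)
      then show "\<exists>y. ((\<lambda>x. Re (\<Phi> (Complex x (Im w1)))) has_real_derivative y) (at x) \<and> 0 < y"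
        using d(2) by (auto simp: has_real_derivative_iff_has_vector_derivative)
    qed
    then show ?thesis
      using w(3) by (simp add: complex_surj) (metis complex.collapse w(3))
  qed
  show ?thesis
  proof (rule inj_onI)
    fix a b assume ab: "a \<in> unit_disc" "b \<in> unit_disc" "f a = f b"
    then have "Im (F a) = Im (F b)" "Re (\<Phi> (F a)) = Re (\<Phi> (F b))"
      using Re_f Im_f by metis+
    then have "Re (F a) = Re (F b)"
      using less[of "F a" "F b"] less[of "F b" "F a"] ab by (cases "Re (F a)" "Re (F b)" rule: linorder_cases) auto
    then have "F a = F b"
      using \<open>Im (F a) = Im (F b)\<close> by (simp add: complex_eq_iff)
    then show "a = b"
      using inj ab by (auto dest: inj_onD)
  qed
qed

section \<open>Minimal surfaces from holomorphic data\<close>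

text \<open>The real part of a holomorphic curve in complex 3-space, a form that is stable under
  both partial derivatives.\<close>

definition Re3 :: "(complex \<Rightarrow> complex) \<Rightarrow> (complex \<Rightarrow> complex) \<Rightarrow> (complex \<Rightarrow> complex) \<Rightarrow>
    complex \<Rightarrow> real ^ 3" where
  "Re3 P Q R z = vector [Re (P z), Re (Q z), Re (R z)]"

text \<open>Writing the vector as a sum makes the standard rules for derivatives and continuity
  applicable.\<close>

lemma vector_3_conv_axis:
  "(vector [a, b, c] :: real ^ 3) = a *\<^sub>R axis 1 1 + b *\<^sub>R axis 2 1 + c *\<^sub>R axis 3 1"
  by (simp add: vec_eq_iff forall_3 axis_def)

lemma Re3_has_derivative:
  assumes "(P has_field_derivative p) (at z)" "(Q has_field_derivative q) (at z)"
    "(R has_field_derivative r) (at z)"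
  shows "(Re3 P Q R has_derivative (\<lambda>v. vector [Re (p * v), Re (q * v), Re (r * v)])) (at z)"
proof -
  have *: "((\<lambda>z. Re (f z)) has_derivative (\<lambda>v. Re (d * v))) (at z)"
    if "(f has_field_derivative d) (at z)" for f d
    using bounded_linear.has_derivative[OF bounded_linear_Re that[unfolded has_field_derivative_def]] .
  show ?thesis
    unfolding Re3_def[abs_def] vector_3_conv_axis
    by (intro has_derivative_add has_derivative_scaleR_left * assms)
qed

context
  fixes S :: "complex set" and P Q R :: "complex \<Rightarrow> complex" and X :: "complex \<Rightarrow> real ^ 3"
  assumes S: "open S"
    and hol: "P holomorphic_on S" "Q holomorphic_on S" "R holomorphic_on S"
    and X: "\<And>z. z \<in> S \<Longrightarrow> X z = Re3 P Q R z"
begin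

text \<open>Agreement with \<open>Re3 P Q R\<close> is assumed on \<open>S\<close> only, so that
  these facts can be applied again to \<open>partial_u X\<close> and \<open>partial_v X\<close>,
  whose formulas are known just there.\<close>

lemma has_derivative_eq_Re3:
  assumes "z \<in> S"
  shows "(X has_derivative (\<lambda>v. vector [Re (deriv P z * v), Re (deriv Q z * v), Re (deriv R z * v)]))
    (at z)"
proof (rule has_derivative_transform_within_open[OF Re3_has_derivative S assms])
  show "(P has_field_derivative deriv P z) (at z)" "(Q has_field_derivative deriv Q z) (at z)"
    "(R has_field_derivative deriv R z) (at z)"
    using hol S assms by (auto intro: holomorphic_derivI)
qed (simp add: X)

lemma partial_u_eq_Re3:
  assumes "z \<in> S"
  shows "partial_u X z = Re3 (deriv P) (deriv Q) (deriv R) z"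
  using frechet_derivative_at[OF has_derivative_eq_Re3[OF assms], symmetric]
  by (simp add: partial_u_def Re3_def)

lemma partial_v_eq_Re3:
  assumes "z \<in> S"
  shows "partial_v X z = Re3 (\<lambda>z. \<i> * deriv P z) (\<lambda>z. \<i> * deriv Q z) (\<lambda>z. \<i> * deriv R z) z"
  using frechet_derivative_at[OF has_derivative_eq_Re3[OF assms], symmetric]
  by (simp add: partial_v_def Re3_def)

lemma C1_on_eq_Re3: "C1_on S X"
proof -
  have cont: "continuous_on S (Re3 p q r)"
    if "p holomorphic_on S" "q holomorphic_on S" "r holomorphic_on S" for p q r
    using that unfolding Re3_def[abs_def] vector_3_conv_axis
    by (intro continuous_intros) (auto intro: holomorphic_on_imp_continuous_on)
  have "X differentiable at z" if "z \<in> S" for z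
    using has_derivative_eq_Re3[OF that] by (auto simp: differentiable_def)
  moreover have "continuous_on S (partial_u X)"
    by (subst continuous_on_cong[OF refl partial_u_eq_Re3])
       (auto intro!: cont holomorphic_intros hol S)
  moreover have "continuous_on S (partial_v X)"
    by (subst continuous_on_cong[OF refl partial_v_eq_Re3])
       (auto intro!: cont holomorphic_intros hol S)
  ultimately show ?thesis
    by (simp add: C1_on_def)
qed

end

text \<open>Both partial derivatives are again real parts of holomorphic triples, so the first-order
  result applies to each of them.\<close>

lemma C2_on_eq_Re3:
  assumes "open S" "P holomorphic_on S" "Q holomorphic_on S" "R holomorphic_on S"
    and "\<And>z. z \<in> S \<Longrightarrow> X z = Re3 P Q R z"
  shows "C2_on S X"
  unfolding C2_on_def
  by (intro conjI C1_on_eq_Re3[OF assms]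
        C1_on_eq_Re3[OF assms(1) _ _ _ partial_u_eq_Re3[OF assms]]
        C1_on_eq_Re3[OF assms(1) _ _ _ partial_v_eq_Re3[OF assms]])
     (auto intro!: holomorphic_intros assms)

text \<open>
  Isotropy of \<open>(P', Q', R')\<close> makes the parametrization conformal (\<open>E = G\<close>, \<open>F = 0\<close>), so the
  mean curvature is a multiple of the normal component of the Laplacian, which vanishes.
\<close>

lemma mean_curvature_isotropic:
  assumes S: "open S" and hol: "P holomorphic_on S" "Q holomorphic_on S" "R holomorphic_on S"
    and X: "\<And>z. z \<in> S \<Longrightarrow> X z = Re3 P Q R z"
    and iso: "\<And>z. z \<in> S \<Longrightarrow> deriv P z ^ 2 + deriv Q z ^ 2 + deriv R z ^ 2 = 0"
    and z: "z \<in> S"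
  shows "mean_curvature X z = 0"
proof -
  note u = partial_u_eq_Re3[OF S hol X] and v = partial_v_eq_Re3[OF S hol X]
  have hol': "deriv P holomorphic_on S" "deriv Q holomorphic_on S" "deriv R holomorphic_on S"
    using hol S by (auto intro: holomorphic_deriv)
  have hol'': "(\<lambda>z. \<i> * deriv P z) holomorphic_on S" "(\<lambda>z. \<i> * deriv Q z) holomorphic_on S"
    "(\<lambda>z. \<i> * deriv R z) holomorphic_on S"
    by (intro holomorphic_intros hol')+
  have d: "deriv (\<lambda>z. \<i> * p z) z = \<i> * deriv p z" if "p holomorphic_on S" for p
    using that S z by (intro deriv_cmult holomorphic_on_imp_differentiable_at)
  \<comment> \<open>Harmonicity: differentiating twice in direction \<open>\<i>\<close> produces the
    factor \<open>\<i> ^ 2 = -1\<close>.\<close>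
  have "partial_v (partial_v X) z = - partial_u (partial_u X) z"
    using z by (simp add: partial_u_eq_Re3[OF S hol' u] partial_v_eq_Re3[OF S hol'' v] d hol'
        Re3_def vec_eq_iff forall_3)
  \<comment> \<open>The real and imaginary parts of the isotropy sum are \<open>E - G\<close> and
    \<open>- 2 F\<close> of the first fundamental form.\<close>
  moreover have
    "partial_u X z \<bullet> partial_u X z - partial_v X z \<bullet> partial_v X z
       = Re (deriv P z ^ 2 + deriv Q z ^ 2 + deriv R z ^ 2)"
    "- 2 * (partial_u X z \<bullet> partial_v X z) = Im (deriv P z ^ 2 + deriv Q z ^ 2 + deriv R z ^ 2)"
    using z by (simp_all add: u v Re3_def inner_vec_def sum_3 power2_eq_square)
  ultimately show ?thesis
    using iso[OF z] by (simp add: mean_curvature_def Let_def)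
qed

text \<open>With \<open>P = h + g\<close> and \<open>Q = - \<i> (h - g)\<close>, the squares of
  \<open>P'\<close> and \<open>Q'\<close> sum to \<open>4 h' g'\<close>, which the condition on
  \<open>R\<close> cancels. Injectivity makes the surface a graph, and \<open>orient\<close> makes
  the Jacobian of the planar map positive.\<close>

lemma lifts_to_minimal_graph_harmonic:
  assumes hol: "h holomorphic_on unit_disc" "g holomorphic_on unit_disc" "R holomorphic_on unit_disc"
    and inj: "inj_on (\<lambda>z. h z + cnj (g z)) unit_disc"
    and orient: "\<And>z. z \<in> unit_disc \<Longrightarrow> norm (deriv g z) < norm (deriv h z)"
    and R: "\<And>z. z \<in> unit_disc \<Longrightarrow> deriv R z ^ 2 = - 4 * deriv h z * deriv g z"
  shows "lifts_to_minimal_graph (\<lambda>z. h z + cnj (g z))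
    (\<lambda>z. vector [Re (h z + g z), Im (h z - g z), Re (R z)])" (is "lifts_to_minimal_graph ?f ?X")
proof -
  define P where "P z = h z + g z" for z
  \<comment> \<open>The factor \<open>- \<i>\<close> turns the imaginary part of
    \<open>h - g\<close> into a real part.\<close>
  define Q where "Q z = - \<i> * (h z - g z)" for z
  have S: "open unit_disc" by simp
  have PQR: "P holomorphic_on unit_disc" "Q holomorphic_on unit_disc" "R holomorphic_on unit_disc"
    unfolding P_def Q_def by (intro holomorphic_intros hol)+
  have X: "?X z = Re3 P Q R z" for z
    by (simp add: Re3_def P_def Q_def)
  have P': "deriv P z = deriv h z + deriv g z" and Q': "deriv Q z = - \<i> * (deriv h z - deriv g z)"
    if "z \<in> unit_disc" for z
  proof -
    have "(h has_field_derivative deriv h z) (at z)" "(g has_field_derivative deriv g z) (at z)"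
      using hol that by (auto intro: holomorphic_derivI)
    then show "deriv P z = deriv h z + deriv g z" "deriv Q z = - \<i> * (deriv h z - deriv g z)"
      unfolding P_def Q_def by (auto intro!: DERIV_imp_deriv derivative_eq_intros)
  qed
  have f_X: "Complex (?X z $ 1) (?X z $ 2) = ?f z" for z
    by (simp add: complex_eq_iff)
  have cont_f: "continuous_on unit_disc ?f"
    using hol by (intro continuous_intros holomorphic_on_imp_continuous_on)
  \<comment> \<open>The planar map is merely harmonic, so invariance of domain takes the place of
    the holomorphic open mapping theorem; it also yields the continuous inverse
    \<open>k\<close>.\<close>
  have open_f: "open (?f ` unit_disc)"
    using invariance_of_domain[OF cont_f S inj] .
  have dom: "is_domain (?f ` unit_disc)"
    unfolding is_domain_def using open_f cont_f by (auto intro: connected_continuous_image)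
  obtain k where k: "homeomorphism unit_disc (?f ` unit_disc) ?f k"
    using invariance_of_domain_homeomorphism[OF S cont_f _ inj] by auto
  have C2: "C2_on unit_disc ?X"
    using C2_on_eq_Re3[OF S PQR X] .
  have cont_X: "continuous_on unit_disc ?X"
    using C2 by (auto simp: C2_on_def C1_on_def
        intro!: continuous_at_imp_continuous_on differentiable_imp_continuous_within)
  \<comment> \<open>The inverse of the parametrization projects to the plane and then applies
    \<open>k\<close>.\<close>
  define proj where "proj x = Complex (x $ 1) (x $ 2)" for x :: "real ^ 3"
  have proj: "proj = (\<lambda>x. of_real (x $ 1) + \<i> * of_real (x $ 2))"
    by (simp add: proj_def complex_eq_iff fun_eq_iff)
  have proj_X: "proj (?X z) = ?f z" for z
    by (simp only: proj_def f_X)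
  have k_f: "k (?f z) = z" if "z \<in> unit_disc" for z
    using k that by (simp add: homeomorphism_def)
  have k_X: "(k \<circ> proj) (?X z) = z" if "z \<in> unit_disc" for z
    using k_f[OF that] by (simp only: o_apply proj_X)
  have "homeomorphism unit_disc (?X ` unit_disc) ?X (k \<circ> proj)"
  proof (rule homeomorphismI)
    have "continuous_on (?X ` unit_disc) proj"
      unfolding proj by (intro continuous_intros)
    moreover have "proj ` ?X ` unit_disc = ?f ` unit_disc"
      by (simp only: image_image proj_X)
    ultimately show "continuous_on (?X ` unit_disc) (k \<circ> proj)"
      using k by (intro continuous_on_compose) (auto simp: homeomorphism_def)
    show "(k \<circ> proj) ` ?X ` unit_disc \<subseteq> unit_disc"
      using k_X by (auto simp only: image_subset_iff)
    show "?X ((k \<circ> proj) x) = x" if "x \<in> ?X ` unit_disc" for x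
      using that by (elim imageE) (simp only: k_X)
  qed (use cont_X k_X in blast)+
  moreover have "cross3 (partial_u ?X z) (partial_v ?X z) \<noteq> 0" if z: "z \<in> unit_disc" for z
  proof -
    \<comment> \<open>The third component of the normal is the Jacobian of the planar map.\<close>
    have "cross3 (partial_u ?X z) (partial_v ?X z) $ 3 = (norm (deriv h z))\<^sup>2 - (norm (deriv g z))\<^sup>2"
      by (simp only: partial_u_eq_Re3[OF S PQR X z] partial_v_eq_Re3[OF S PQR X z]
          cross_components Re3_def vector_3 P'[OF z] Q'[OF z] cmod_power2)
        (simp add: power2_eq_square algebra_simps)
    also have "\<dots> > 0"
      using orient[OF z] by (simp add: power_strict_mono)
    finally show ?thesis by auto
  qed
  ultimately have patch: "regular_patch unit_disc ?X"
    unfolding regular_patch_def using C2 by auto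
  have "mean_curvature ?X z = 0" if z: "z \<in> unit_disc" for z
  proof (rule mean_curvature_isotropic[OF S PQR X _ z])
    fix w assume w: "w \<in> unit_disc"
    show "(deriv P w)\<^sup>2 + (deriv Q w)\<^sup>2 + (deriv R w)\<^sup>2 = 0"
      by (simp only: R[OF w] P'[OF w] Q'[OF w] power_mult_distrib)
        (simp add: power2_eq_square algebra_simps)
  qed
  moreover have "local_parametrization (?X ` unit_disc) unit_disc ?X"
    using patch by (simp add: local_parametrization_def)
  ultimately have "minimal_surface (?X ` unit_disc)"
    unfolding minimal_surface_def by blast
  moreover have "?X ` unit_disc = graph_over (?f ` unit_disc) (\<lambda>w. Re (R (k w)))"
  proof -
    have "?X z = vector [Re (?f z), Im (?f z), Re (R (k (?f z)))]" if "z \<in> unit_disc" for z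
      using k_f[OF that] by simp
    then show ?thesis
      unfolding graph_over_def by force
  qed
  ultimately show ?thesis
    unfolding lifts_to_minimal_graph_def minimal_graph_def using dom patch f_X by blast
qed

section \<open>The shear of \<open>z - z ^ n / n\<^sup>2\<close>\<close>

text \<open>Differentiating \<open>exp (L w) = w ^ n - 1\<close> in two ways determines
  \<open>deriv L\<close> without an explicit formula for the branch.\<close>

lemma is_log_branch_has_field_derivative:
  assumes "is_log_branch n L" "z \<in> unit_disc"
  shows "(L has_field_derivative of_nat n * z ^ (n - 1) / (z ^ n - 1)) (at z)"
proof -
  have L: "(L has_field_derivative deriv L z) (at z)"
    using assms by (auto simp: is_log_branch_def intro: holomorphic_derivI)
  have exp_L: "exp (L w) = w ^ n - 1" if "w \<in> unit_disc" for w
    using assms(1) that by (simp add: is_log_branch_def)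
  have "((\<lambda>w. exp (L w)) has_field_derivative exp (L z) * deriv L z) (at z)"
    using DERIV_chain2[OF DERIV_exp L] .
  moreover have "((\<lambda>w. exp (L w)) has_field_derivative of_nat n * z ^ (n - 1)) (at z)"
    by (rule has_field_derivative_transform_within_open[of "\<lambda>w. w ^ n - 1" _ _ unit_disc])
       (use assms(2) in \<open>auto intro!: derivative_eq_intros simp: exp_L simp del: mem_ball\<close>)
  ultimately have "exp (L z) * deriv L z = of_nat n * z ^ (n - 1)"
    by (rule DERIV_unique)
  moreover have "exp (L z) \<noteq> 0"
    by simp
  ultimately have "deriv L z = of_nat n * z ^ (n - 1) / exp (L z)"
    by (simp add: field_simps)
  then have "deriv L z = of_nat n * z ^ (n - 1) / (z ^ n - 1)"
    by (simp only: exp_L[OF assms(2)])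
  with L show ?thesis by simp
qed

lemma power_ne_1_unit_disc:
  fixes z :: complex
  assumes "z \<in> unit_disc" "n > 0"
  shows "norm (z ^ n) < 1" "1 - z ^ n \<noteq> 0"
proof -
  show less: "norm (z ^ n) < 1"
    using assms by (simp add: norm_power power_less_one_iff)
  show "1 - z ^ n \<noteq> 0"
  proof
    assume "1 - z ^ n = 0"
    then have "z ^ n = 1" by simp
    with less show False by simp
  qed
qed

text \<open>This is the primitive of \<open>z ^ m h'\<close> for \<open>n = 2 m\<close>. With
  \<open>w = z ^ m\<close>, the hypergeometric difference contributes
  \<open>w / (1 - w ^ 2)\<close>, and the \<open>artanh\<close> term contributes the part containing
  \<open>z ^ (2 * m - 1)\<close>.\<close>

lemma shear_coordinate_has_field_derivative:
  fixes m :: nat and z :: complex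
  assumes "m > 0" "z \<in> unit_disc"
  shows "((\<lambda>z. 1 / 2 * (z * hyp2F1 1 (1 / of_nat m) (1 / of_nat m + 1) (z ^ m)
              - z * hyp2F1 1 (1 / of_nat m) (1 / of_nat m + 1) (- (z ^ m)))
            - 1 / (2 * of_nat m) * ((artanh (z ^ m) - z ^ m) / of_nat m))
          has_field_derivative
            z ^ m * ((1 - z ^ (2 * m - 1) / of_nat (2 * m)) / (1 - z ^ (2 * m)))) (at z)"
proof -
  define w where "w = z ^ m"
  define v where "v = z ^ (m - 1)"
  have norm: "norm w < 1" and ne: "1 - w \<noteq> 0" "1 - w ^ 2 \<noteq> 0"
    using power_ne_1_unit_disc[OF assms(2,1)] power_ne_1_unit_disc[OF assms(2), of "m * 2"] assms(1)
    by (simp_all add: w_def power_mult)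
  then have ne': "1 + w \<noteq> 0"
    by (metis mult_zero_left power2_eq_square right_minus_eq square_eq_1_iff add_eq_0_iff2 add.inverse_inverse)
  have hyp: "((\<lambda>z. z * hyp2F1 1 (1 / of_nat m) (1 / of_nat m + 1) (z ^ m))
      has_field_derivative 1 / (1 - w)) (at z)"
    "((\<lambda>z. z * hyp2F1 1 (1 / of_nat m) (1 / of_nat m + 1) (- (z ^ m)))
      has_field_derivative 1 / (1 + w)) (at z)"
    using has_field_derivative_hyp2F1_one_inverse[of m 1 z]
      has_field_derivative_hyp2F1_one_inverse[of m "-1" z] assms by (simp_all add: w_def)
  have pow: "((\<lambda>z. z ^ m) has_field_derivative of_nat m * v) (at z)"
    by (auto intro!: derivative_eq_intros simp: v_def)
  have "((\<lambda>z. artanh (z ^ m)) has_field_derivative 1 / (1 - w ^ 2) * (of_nat m * v)) (at z)"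
    using DERIV_chain2[OF artanh_has_field_derivative_complex pow] norm by (simp add: w_def)
  from DERIV_diff[OF DERIV_cmult[OF DERIV_diff[OF hyp], of "1 / 2"]
      DERIV_cmult[OF DERIV_cdivide[OF DERIV_diff[OF this pow], of "of_nat m"], of "1 / (2 * of_nat m)"]]
  show ?thesis
  proof (rule DERIV_cong)
    have "2 * m - 1 = m + (m - 1)"
      using assms(1) by simp
    then have z: "z ^ (2 * m - 1) = w * v" "z ^ (2 * m) = w ^ 2"
      by (simp_all only: w_def v_def power_add mult.commute[of 2] power_mult)
    have "1 / (1 - w) - 1 / (1 + w) = 2 * w / (1 - w ^ 2)"
      using ne ne' by (simp add: field_simps power2_eq_square)
    moreover have "1 / (1 - w ^ 2) * (of_nat m * v) - of_nat m * v = of_nat m * v * w ^ 2 / (1 - w ^ 2)"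
      using ne by (simp add: field_simps)
    moreover have alg: "1 / 2 * (2 * w / D) - 1 / (2 * M) * (M * v * w ^ 2 / D / M)
        = w * ((1 - w * v / (2 * M)) / D)" if "M \<noteq> 0" "D \<noteq> 0" for M D :: complex
      using that by (simp add: field_simps power2_eq_square)
    ultimately show "1 / 2 * (1 / (1 - w) - 1 / (1 + w)) -
        1 / (2 * of_nat m) * ((1 / (1 - w ^ 2) * (of_nat m * v) - of_nat m * v) / of_nat m)
      = z ^ m * ((1 - z ^ (2 * m - 1) / of_nat (2 * m)) / (1 - z ^ (2 * m)))"
      by (simp only: z(2) flip: w_def)
        (simp only: of_nat_mult of_nat_numeral alg[OF _ ne(2), of "of_nat m"] z(1) assms(1)
          of_nat_eq_0_iff neq0_conv)
  qed
qed

theorem theorem6: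
  fixes n :: nat and L F h g f :: "complex \<Rightarrow> complex"
  assumes n: "n \<ge> 2"
    and L: "is_log_branch n L"
  defines "F \<equiv> \<lambda>z. z - 1 / of_nat n ^ 2 * z ^ n"
    and "h \<equiv> \<lambda>z. z * hyp2F1 1 (1 / of_nat n) (1 / of_nat n + 1) (z ^ n)
                 + L z / of_nat n ^ 2 - complex_of_real pi * \<i> / of_nat n ^ 2"
    and "g \<equiv> \<lambda>z. z * hyp2F1 1 (1 / of_nat n) ((of_nat n + 1) / of_nat n) (z ^ n) - z
                 + (L z + z ^ n) / of_nat n ^ 2 - complex_of_real pi * \<i> / of_nat n ^ 2"
    and "f \<equiv> \<lambda>z. h z + cnj (g z)"
  shows "conformal_univalent_on unit_disc F \<and> is_domain (F ` unit_disc) \<and>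
         convex_in_real_direction (F ` unit_disc) \<and>
         horizontal_shear F (\<lambda>z. z ^ n) h g f \<and>
         f \<in> S_H0 \<and>
         (\<forall>m. n = 2 * m \<longrightarrow>
           lifts_to_minimal_graph f
             (\<lambda>z. vector
               [Re (h z + g z),
                Im (h z - g z),
                2 * Im (1 / 2 * (z * hyp2F1 1 (1 / of_nat m) (1 / of_nat m + 1) (z ^ m)
                                 - z * hyp2F1 1 (1 / of_nat m) (1 / of_nat m + 1) (- (z ^ m)))
                        - 1 / (2 * of_nat m) * ((artanh (z ^ m) - z ^ m) / of_nat m))]))"
proof -
  \<comment> \<open>This will be \<open>h'\<close>: the relation
    \<open>F' = (1 - \<omega>) h'\<close> forces the numerator \<open>F'\<close> and the denominator
    \<open>1 - z ^ n\<close>.\<close>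
  define q where "q z = (1 - z ^ (n - 1) / of_nat n) / (1 - z ^ n)" for z :: complex
  have n0: "n > 0" "(of_nat n :: complex) \<noteq> 0"
    using n by auto
  have F_eq: "F = (\<lambda>z. z - z ^ n / of_nat n ^ 2)"
    by (simp add: F_def fun_eq_iff)
  have F': "(F has_field_derivative 1 - z ^ (n - 1) / of_nat n) (at z)" for z
    unfolding F_eq
    by (rule DERIV_cong[OF DERIV_diff[OF DERIV_ident DERIV_cdivide[OF DERIV_power[OF DERIV_ident]]]])
       (simp add: power2_eq_square n0)
  have holF: "F holomorphic_on unit_disc"
    using F' by (auto simp: holomorphic_on_open)
  have injF: "inj_on F unit_disc"
    unfolding F_eq using inj_on_id_minus_power[OF n] by (rule inj_on_subset) auto
  have univ: "conformal_univalent_on unit_disc F"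
    unfolding conformal_univalent_on_def
    using holF injF holomorphic_injective_imp_regular[OF holF _ injF] by simp
  have convF: "convex (F ` unit_disc)"
    unfolding F_eq using convex_image_id_minus_power[OF n] .
  have domF: "is_domain (F ` unit_disc)"
    unfolding is_domain_def
    using convex_connected[OF convF] open_mapping_thm3[OF holF open_ball injF] by simp
  have crdF: "convex_in_real_direction (F ` unit_disc)"
    using convex_imp_convex_in_real_direction[OF convF] .
  have h': "(h has_field_derivative q z) (at z)" if z: "z \<in> unit_disc" for z
  proof -
    have hyp: "((\<lambda>z. z * hyp2F1 1 (1 / of_nat n) (1 / of_nat n + 1) (z ^ n))
        has_field_derivative 1 / (1 - z ^ n)) (at z)"
      using has_field_derivative_hyp2F1_one_inverse[of n 1 z] z n0 by simp
    have "z ^ n - 1 \<noteq> 0" "1 - z ^ n \<noteq> 0"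
      using power_ne_1_unit_disc(2)[OF z n0(1)] by auto
    \<comment> \<open>The sign comes from \<open>z ^ n - 1 = - (1 - z ^ n)\<close>, and one factor
      \<open>n\<close> of the denominator cancels.\<close>
    then have "of_nat n * z ^ (n - 1) / (z ^ n - 1) / of_nat n ^ 2
        = - (z ^ (n - 1) / of_nat n) / (1 - z ^ n)"
      using n0 by (simp add: divide_simps power2_eq_square) (simp add: algebra_simps)
    then have "1 / (1 - z ^ n) + of_nat n * z ^ (n - 1) / (z ^ n - 1) / of_nat n ^ 2 - 0 = q z"
      by (simp add: q_def diff_divide_distrib)
    then show ?thesis
      unfolding h_def
      by (rule DERIV_cong[OF DERIV_diff[OF DERIV_add[OF hyp
            DERIV_cdivide[OF is_log_branch_has_field_derivative[OF L z]]] DERIV_const]])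
  qed
  \<comment> \<open>The two hypergeometric terms agree because
    \<open>(n + 1) / n = 1 / n + 1\<close>, and the logarithms and constants cancel.\<close>
  have g_eq: "g z = h z - F z" for z
    using n0 by (simp add: g_def h_def F_def add_divide_distrib add.commute[of 1])
  have g': "(g has_field_derivative z ^ n * q z) (at z)" if z: "z \<in> unit_disc" for z
  proof -
    have "(1 - z ^ n) * q z = 1 - z ^ (n - 1) / of_nat n"
      using power_ne_1_unit_disc(2)[OF z n0(1)] by (simp add: q_def)
    then have "q z - (1 - z ^ (n - 1) / of_nat n) = z ^ n * q z"
      by (simp add: algebra_simps)
    then show ?thesis
      unfolding g_eq[abs_def] by (rule DERIV_cong[OF DERIV_diff[OF h'[OF z] F']])
  qed
  have hol: "h holomorphic_on unit_disc" "g holomorphic_on unit_disc"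
    unfolding holomorphic_on_open[OF open_ball] using h' g' by blast+
  have deriv: "deriv h z = q z" "deriv g z = z ^ n * q z" if "z \<in> unit_disc" for z
    using h' g' that by (auto intro: DERIV_imp_deriv)
  \<comment> \<open>The constant \<open>\<pi> \<i> / n ^ 2\<close> compensates the value
    \<open>L 0 = \<pi> \<i>\<close>.\<close>
  have zero: "h 0 = 0" "g 0 = 0"
    using L n0 by (simp_all add: h_def g_eq F_def is_log_branch_def power_0_left)
  have shear: "horizontal_shear F (\<lambda>z. z ^ n) h g f"
    unfolding horizontal_shear_def
    using holF injF hol deriv zero power_ne_1_unit_disc(1)[OF _ n0(1)] n0
    by (auto simp: g_eq f_def power_0_left F_def intro!: holomorphic_intros)
  have injf: "inj_on f unit_disc"
    using horizontal_shear_inj_on[OF shear crdF] .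
  \<comment> \<open>Here \<open>n \<ge> 2\<close> makes the exponent \<open>n - 1\<close> positive,
    so that the power vanishes at the origin.\<close>
  have "q 0 = 1"
    using n by (simp add: q_def power_0_left)
  then have "deriv h 0 = 1" "deriv g 0 = 0"
    using deriv[of 0] n0 by (simp_all add: power_0_left)
  then have SH: "f \<in> S_H0"
    unfolding S_H0_def mem_Collect_eq
    by (intro conjI exI[of _ h] exI[of _ g] injf hol zero) (simp_all add: f_def)
  \<comment> \<open>\<open>K\<close> is an arbitrary primitive of \<open>z ^ m h'\<close>, which
    keeps the closed formula out of the geometric argument.\<close>
  have lift: "lifts_to_minimal_graph f (\<lambda>z. vector [Re (h z + g z), Im (h z - g z), 2 * Im (K z)])"
    if m: "n = 2 * m" and K: "\<And>z. z \<in> unit_disc \<Longrightarrow> (K has_field_derivative z ^ m * q z) (at z)"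
    for m and K :: "complex \<Rightarrow> complex"
  proof -
    \<comment> \<open>The factor \<open>- 2 \<i>\<close> gives \<open>Re (R z) = 2 Im (K z)\<close>
      and makes the square of \<open>R'\<close> equal to
      \<open>- 4 z ^ n (q z) ^ 2 = - 4 h' g'\<close>, as isotropy demands.\<close>
    define R where "R z = - 2 * \<i> * K z" for z
    have R': "(R has_field_derivative - 2 * \<i> * (z ^ m * q z)) (at z)" if "z \<in> unit_disc" for z
      unfolding R_def using K[OF that] by (rule DERIV_cmult)
    have "lifts_to_minimal_graph (\<lambda>z. h z + cnj (g z))
        (\<lambda>z. vector [Re (h z + g z), Im (h z - g z), Re (R z)])"
    proof (rule lifts_to_minimal_graph_harmonic[OF hol])
      show "R holomorphic_on unit_disc"
        unfolding holomorphic_on_open[OF open_ball] using R' by blast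
      show "inj_on (\<lambda>z. h z + cnj (g z)) unit_disc"
        using injf by (simp add: f_def)
    next
      fix z assume z: "z \<in> unit_disc"
      \<comment> \<open>A zero of \<open>q\<close> would need \<open>z ^ (n - 1) = n\<close>, which
        has norm greater than 1; with \<open>h'\<close> nonzero, \<open>norm g' < norm h'\<close> is
        strict.\<close>
      have "norm (z ^ (n - 1)) < 1"
        using power_ne_1_unit_disc(1)[OF z, of "n - 1"] n by simp
      then have "norm (z ^ (n - 1)) < real n"
        using n by linarith
      then have "z ^ (n - 1) \<noteq> of_nat n"
        by auto
      then have "q z \<noteq> 0"
        using power_ne_1_unit_disc(2)[OF z n0(1)] n0 by (simp add: q_def)
      then show "norm (deriv g z) < norm (deriv h z)"
        using power_ne_1_unit_disc(1)[OF z n0(1)] by (simp add: deriv[OF z] norm_mult)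
      show "deriv R z ^ 2 = - 4 * deriv h z * deriv g z"
      proof -
        have "z ^ n = (z ^ m) ^ 2"
          by (simp only: m mult.commute[of 2] power_mult)
        then show ?thesis
          by (simp only: DERIV_imp_deriv[OF R'[OF z]] deriv[OF z] power_mult_distrib)
            (simp add: power2_eq_square)
      qed
    qed
    then show ?thesis
      by (simp add: R_def f_def)
  qed
  show ?thesis
  proof (intro conjI univ domF crdF shear SH allI impI, goal_cases)
    case (1 m)
    then show ?case
      using shear_coordinate_has_field_derivative[of m] n
      by (intro lift[of m]) (simp_all add: q_def)
  qed
qed

end
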